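(* Fix $a\in\mathbb{Z}$, let $\delta=a^2-4$, and define $(u_n)_{n\geq 0}$ and $(v_n)_{n\geq 0}$ by $u_0=0$, $u_1=1$, $u_{n+2}=au_{n+1}-u_n$ and $v_0=2$, $v_1=a$, $v_{n+2}=av_{n+1}-v_n$. Let $\ell\geq 3$ be a rational prime with $\ell\nmid\delta$, and suppose that $\ell$ divides some nonzero term of $(u_n)$. Let $\rho_\ell\geq 1$ be the smallest index such that $u_{\rho_\ell}\neq 0$ and $\ell\mid u_{\rho_\ell}$, and put $r_\ell=v_\ell(u_{\rho_\ell})$. Set $h_\ell=1$ if $\ell=3$, and $h_\ell=0$ otherwise. Then $$v_\ell(u_{\ell\rho_\ell}-\ell u_{\rho_\ell})=3r_\ell+1-h_\ell\quad\text{and}\quad v_\ell(v_{\ell\rho_\ell}-v_{\rho_\ell})=2r_\ell.$$ Consequently, $$\begin{aligned}\ell^2\mid u_{\rho_\ell}\quad&\Longleftrightarrow\quad\ell^{7-h_\ell}\mid u_{\ell\rho_\ell}-\ell u_{\rho_\ell}\quad\Longleftrightarrow\quad\ell^4\mid v_{\ell\rho_\ell}-v_{\rho_\ell}\\&\Longleftrightarrow\quad\ell^{5-h_\ell}\mid u_{\ell\rho_\ell}-\ell u_{\rho_\ell}\quad\Longleftrightarrow\quad\ell^3\mid v_{\ell\rho_\ell}-v_{\rho_\ell},\end{aligned}$$ and $$r_\ell=\frac{v_\ell(u_{\ell\rho_\ell}-\ell u_{\rho_\ell})+h_\ell-1}{3}=\frac{v_\ell(v_{\ell\rho_\ell}-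v_{\rho_\ell})}{2}.$$
   Context: For a prime $\ell$, $v_\ell(\cdot)$ denotes the usual $\ell$-adic valuation on $\mathbb{Q}$, with $v_\ell(0)=\infty$ (not to be confused with the terms $v_n$ of the companion sequence). (A prime $\ell$ as in the claim is called a Lucas–Wieferich prime for $(u_n)_{n\ge 1}$ if $r_\ell\geq 2$.) *)

theory Defs
  imports "HOL-Computational_Algebra.Primes" "HOL-Library.Extended_Real"
begin

fun lucas_u :: "int \<Rightarrow> nat \<Rightarrow> int" where
  "lucas_u a 0 = 0"
| "lucas_u a (Suc 0) = 1"
| "lucas_u a (Suc (Suc n)) = a * lucas_u a (Suc n) - lucas_u a n"

fun lucas_v :: "int \<Rightarrow> nat \<Rightarrow> int" where
  "lucas_v a 0 = 2"
| "lucas_v a (Suc 0) = a"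
| "lucas_v a (Suc (Suc n)) = a * lucas_v a (Suc n) - lucas_v a n"

(* The library's multiplicity is 0 at 0, so the value \<infinity> is set separately. Values lie in
   the integers together with \<infinity>; the type ereal is used so that such values can also be
   subtracted from and divided by numerals. *)
definition padic_val :: "nat \<Rightarrow> rat \<Rightarrow> ereal" where
  "padic_val p x =
     (if x = 0 then \<infinity>
      else ereal (real (multiplicity (int p) (fst (quotient_of x)))
                - real (multiplicity (int p) (snd (quotient_of x)))))"

(* Meaningful only if p divides some nonzero term of the sequence. *)
definition lucas_rho :: "int \<Rightarrow> nat \<Rightarrow> nat" where
  "lucas_rho a p = (LEAST n. n \<ge> 1 \<and> lucas_u a n \<noteq> 0 \<and> int p dvd lucas_u a n)"

end

theory Submission
  imports Defs
begin

text \<open>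
  Put \<open>U = u\<^sub>\<rho>\<close>, \<open>V = v\<^sub>\<rho>\<close> and \<open>X = V\<^sup>2 - 4 = \<delta> U\<^sup>2\<close>. Writing \<open>u\<^sub>n(V)\<close> and \<open>v\<^sub>n(V)\<close> for the two
  sequences with parameter \<open>V\<close> instead of \<open>a\<close>, one has \<open>u\<^sub>l\<^sub>\<rho> = U u\<^sub>l(V)\<close> and \<open>v\<^sub>l\<^sub>\<rho> = v\<^sub>l(V)\<close>. For odd
  \<open>l = 2 k + 1\<close> the terms \<open>u\<^sub>l(V)\<close> and \<open>v\<^sub>l(V) / V\<close> are polynomials in \<open>X\<close> with
  \<open>u\<^sub>l(V) \<equiv> l + (\<Sum>i\<le>k. i\<^sup>2) X\<close> and \<open>v\<^sub>l(V) / V \<equiv> 1 + (\<Sum>i\<le>k. i) X\<close> modulo \<open>X\<^sup>2\<close>. Since \<open>l\<^sup>2\<close> divides \<open>X\<close>, the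
  valuations of both differences are decided by the linear coefficients \<open>k (k + 1) l / 6\<close> and
  \<open>k (k + 1) / 2\<close>; the first is a unit exactly for \<open>l = 3\<close>.
\<close>

text \<open>Substitute v_n = 2 u_(n+1) - a u_n and complete the square in the invariant quadratic
  form u_(n+1)^2 - a u_(n+1) u_n + u_n^2 = 1.\<close>

lemma lucas_v_square: "lucas_v a n ^ 2 = (a\<^sup>2 - 4) * lucas_u a n ^ 2 + 4"
proof -
  have v: "lucas_v a n = 2 * lucas_u a (Suc n) - a * lucas_u a n"
  proof (induction n rule: induct_nat_012)
    case (ge2 n)
    then show ?case unfolding lucas_v.simps lucas_u.simps by algebra
  qed simp_all
  have "lucas_u a (Suc n) ^ 2 - a * lucas_u a (Suc n) * lucas_u a n + lucas_u a n ^ 2 = 1"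
  proof (induction n)
    case (Suc n)
    then show ?case unfolding lucas_u.simps by algebra
  qed simp
  then show ?thesis
    unfolding v by algebra
qed

text \<open>If x and 1/x are the characteristic roots, then v_n = x^n + x^(-n), so sampling any
  solution \<open>f\<close> at step \<open>n\<close> gives the same recurrence with parameter v_n. A
  general \<open>f\<close> covers both sequences.\<close>

lemma lucas_rec_add_double:
  fixes f :: "nat \<Rightarrow> int"
  assumes "\<And>k. f (Suc (Suc k)) = a * f (Suc k) - f k"
  shows "f (m + 2 * n) = lucas_v a n * f (m + n) - f m"
  using assms
proof (induction a n arbitrary: m rule: lucas_v.induct)
  case (3 a n)
  have rec: "f (m + 2 * n + 4) = a * f (m + 2 * n + 3) - f (m + 2 * n + 2)"
    "f (m + 2) = a * f (m + 1) - f m"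
    using "3.prems"[of "m + 2 * n + 2"] "3.prems"[of m] by (simp_all add: numeral_eq_Suc)
  \<comment> \<open>Shifting \<open>m\<close> by 1 and by 2 centres both instances of the induction
    hypothesis at \<open>m + n + 2\<close>, so they combine through the recurrence of
    \<open>lucas_v\<close>.\<close>
  have "f (m + 2 * n + 3) = lucas_v a (Suc n) * f (m + n + 2) - f (m + 1)"
    "f (m + 2 * n + 2) = lucas_v a n * f (m + n + 2) - f (m + 2)"
    using "3.IH"(1)[OF "3.prems", of "m + 1"] "3.IH"(2)[OF "3.prems", of "m + 2"]
    by (simp_all add: algebra_simps numeral_3_eq_3)
  then have "lucas_v a (Suc (Suc n)) * f (m + n + 2) =
      a * (f (m + 2 * n + 3) + f (m + 1)) - f (m + 2 * n + 2) - f (m + 2)"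
    by (simp add: left_diff_distrib right_diff_distrib distrib_left)
  also have "\<dots> = f (m + 2 * n + 4) + f m"
    using rec by (simp add: distrib_left)
  finally have "f (m + 2 * n + 4) = lucas_v a (Suc (Suc n)) * f (m + n + 2) - f m"
    by simp
  moreover have "m + 2 * Suc (Suc n) = m + 2 * n + 4" "m + Suc (Suc n) = m + n + 2"
    by simp_all
  ultimately show ?case
    by metis
qed simp_all

text \<open>As functions of \<open>m\<close>, both sides obey the recurrence with parameter v_n and
  agree at m = 0 and m = 1.\<close>

lemma lucas_mult:
  "lucas_u a (m * n) = lucas_u a n * lucas_u (lucas_v a n) m"
  "lucas_v a (m * n) = lucas_v (lucas_v a n) m"
proof (induction m rule: induct_nat_012)
  case (ge2 m)
  { case 1
    show ?case using ge2 lucas_rec_add_double[of "lucas_u a" a "m * n" n]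
      by (simp add: algebra_simps mult_2_right)
  next
    case 2
    show ?case using ge2 lucas_rec_add_double[of "lucas_v a" a "m * n" n]
      by (simp add: algebra_simps mult_2_right) }
qed simp_all

text \<open>The step-two parameter a^2 - 2 is written in terms of a^2 - 4, the variable of the
  expansions below.\<close>

lemma lucas_add_4:
  fixes f :: "nat \<Rightarrow> int"
  assumes "\<And>k. f (Suc (Suc k)) = a * f (Suc k) - f k"
  shows "f (Suc (Suc (Suc (Suc k)))) = (a\<^sup>2 - 4 + 2) * f (Suc (Suc k)) - f k"
  unfolding assms by (simp add: algebra_simps power2_eq_square)

lemma lucas_u_odd_expansion:
  "\<exists>d. lucas_u c (2 * k + 1) = int (2 * k + 1) + (c\<^sup>2 - 4) * (\<Sum>i\<le>k. int i ^ 2) + (c\<^sup>2 - 4)\<^sup>2 * d"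
proof (induction k rule: induct_nat_012)
  case 1
  show ?case by (intro exI[of _ 0]) (simp add: numeral_3_eq_3 power2_eq_square)
next
  case (ge2 k)
  then obtain d d' where *:
    "lucas_u c (Suc (2 * k)) = int (2 * k + 1) + (c\<^sup>2 - 4) * (\<Sum>i\<le>k. int i ^ 2) + (c\<^sup>2 - 4)\<^sup>2 * d"
    "lucas_u c (Suc (Suc (Suc (2 * k)))) = int (2 * k + 3) + (c\<^sup>2 - 4) * ((\<Sum>i\<le>k. int i ^ 2) + (int k + 1)^2) + (c\<^sup>2 - 4)\<^sup>2 * d'"
    by (auto simp: algebra_simps)
  have "lucas_u c (2 * Suc (Suc k) + 1) =
    (c\<^sup>2 - 4 + 2) * lucas_u c (Suc (Suc (Suc (2 * k)))) - lucas_u c (Suc (2 * k))"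
    using lucas_add_4[of "lucas_u c" c "Suc (2 * k)"] by simp
  \<comment> \<open>The new remainder collects the linear coefficient at \<open>Suc k\<close>,
    raised to second order by the factor c^2 - 4, and the two old remainders.\<close>
  also have "\<dots> = int (2 * Suc (Suc k) + 1) + (c\<^sup>2 - 4) * (\<Sum>i\<le>Suc (Suc k). int i ^ 2) +
      (c\<^sup>2 - 4)\<^sup>2 * ((\<Sum>i\<le>Suc k. int i ^ 2) + (c\<^sup>2 - 4 + 2) * d' - d)"
    unfolding * by (simp add: algebra_simps power2_eq_square)
  finally show ?case by blast
qed (auto intro: exI[of _ 0])

lemma lucas_v_odd_expansion:
  "\<exists>d. lucas_v c (2 * k + 1) = c * (1 + (c\<^sup>2 - 4) * (\<Sum>i\<le>k. int i) + (c\<^sup>2 - 4)\<^sup>2 * d)"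
proof (induction k rule: induct_nat_012)
  case 1
  show ?case by (intro exI[of _ 0]) (simp add: numeral_3_eq_3 power2_eq_square algebra_simps)
next
  case (ge2 k)
  then obtain d d' where *:
    "lucas_v c (Suc (2 * k)) = c * (1 + (c\<^sup>2 - 4) * (\<Sum>i\<le>k. int i) + (c\<^sup>2 - 4)\<^sup>2 * d)"
    "lucas_v c (Suc (Suc (Suc (2 * k)))) = c * (1 + (c\<^sup>2 - 4) * ((\<Sum>i\<le>k. int i) + (int k + 1)) + (c\<^sup>2 - 4)\<^sup>2 * d')"
    by (auto simp: algebra_simps)
  have "lucas_v c (2 * Suc (Suc k) + 1) =
    (c\<^sup>2 - 4 + 2) * lucas_v c (Suc (Suc (Suc (2 * k)))) - lucas_v c (Suc (2 * k))"
    using lucas_add_4[of "lucas_v c" c "Suc (2 * k)"] by simp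
  also have "\<dots> = c * (1 + (c\<^sup>2 - 4) * (\<Sum>i\<le>Suc (Suc k). int i) +
      (c\<^sup>2 - 4)\<^sup>2 * ((\<Sum>i\<le>Suc k. int i) + (c\<^sup>2 - 4 + 2) * d' - d))"
    unfolding * by (simp add: algebra_simps power2_eq_square)
  finally show ?case by blast
qed (auto intro: exI[of _ 0])

lemma sum_squares_times_6: "6 * (\<Sum>i\<le>k. int i ^ 2) = int k * (int k + 1) * int (2 * k + 1)"
  by (induction k) (auto simp: algebra_simps power2_eq_square)

lemma sum_times_2: "2 * (\<Sum>i\<le>k. int i) = int k * (int k + 1)"
  by (induction k) (auto simp: algebra_simps)

lemma padic_val_of_int: "z \<noteq> 0 \<Longrightarrow> padic_val p (of_int z) = ereal (real (multiplicity (int p) z))"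
  by (simp add: padic_val_def)

text \<open>The multiplicity of \<open>B\<close> is that of the sum of squares \<open>S\<close>,
  read off from 6 S = k (k + 1) l; the rest of \<open>B\<close> is divisible by l^2.\<close>

lemma lucas_u_prime_expansion:
  fixes c :: int
  assumes l: "prime l" "l \<ge> 3" and X: "int l ^ 2 dvd c\<^sup>2 - 4"
  obtains B where "lucas_u c l = int l + (c\<^sup>2 - 4) * B" "B \<noteq> 0"
    "multiplicity (int l) B = (if l = 3 then 0 else 1)"
proof -
  have "odd l" using l prime_odd_nat by auto
  then obtain k where k: "l = 2 * k + 1" by (rule oddE)
  obtain d where d: "lucas_u c l = int l + (c\<^sup>2 - 4) * (\<Sum>i\<le>k. int i ^ 2) + (c\<^sup>2 - 4)\<^sup>2 * d"
    using lucas_u_odd_expansion[of c k] k by auto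
  define S where "S = (\<Sum>i\<le>k. int i ^ 2)"
  define B where "B = S + (c\<^sup>2 - 4) * d"
  have B: "lucas_u c l = int l + (c\<^sup>2 - 4) * B"
    unfolding d B_def S_def by (simp add: algebra_simps power2_eq_square)
  have S6: "6 * S = int k * (int k + 1) * int l"
    using sum_squares_times_6[of k] by (simp add: S_def k)
  have pl: "prime (int l)" using l by simp
  have mult: "B \<noteq> 0 \<and> multiplicity (int l) B = (if l = 3 then 0 else 1)"
  proof (cases "l = 3")
    case True
    then have "S = 1" using k by (simp add: S_def)
    moreover have "int l dvd (c\<^sup>2 - 4) * d"
      using X by (meson dvd_mult2 dvd_power dvd_trans zero_less_numeral)
    ultimately have "\<not> int l dvd B"
      using True by (auto simp: B_def dvd_add_left_iff)
    then show ?thesis using True not_dvd_imp_multiplicity_0[of "int l" B] by auto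
  next
    case False
    \<comment> \<open>Both k and k + 1 lie strictly between 0 and l = 2 k + 1.\<close>
    have kk: "\<not> int l dvd int k" "\<not> int l dvd int k + 1"
      using zdvd_not_zless[of "int k" "int l"] zdvd_not_zless[of "int k + 1" "int l"] k l by auto
    have "\<not> int l dvd 2" "\<not> int l dvd 3"
      using zdvd_not_zless[of 2 "int l"] zdvd_not_zless[of 3 "int l"] False l by auto
    then have n6: "\<not> int l dvd 6"
      using prime_dvd_mult_iff[OF pl, of 2 3] by simp
    have "int l dvd S"
      using S6 n6 pl by (metis dvd_triv_right prime_dvd_mult_iff)
    moreover have "\<not> int l ^ 2 dvd S"
    proof
      assume "int l ^ 2 dvd S"
      then have "int l * int l dvd int k * (int k + 1) * int l"
        using S6 by (metis dvd_mult power2_eq_square)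
      then have "int l dvd int k * (int k + 1)"
        using l by simp
      then show False using kk pl by (simp add: prime_dvd_mult_iff)
    qed
    moreover have "int l ^ 2 dvd (c\<^sup>2 - 4) * d" using X by simp
    moreover from this have "int l dvd (c\<^sup>2 - 4) * d"
      by (meson dvd_power dvd_trans zero_less_numeral)
    ultimately have "int l ^ 1 dvd B" "\<not> int l ^ Suc 1 dvd B"
      by (simp_all add: B_def dvd_add_left_iff flip: numeral_2_eq_2)
    then show ?thesis using False multiplicity_eqI[of "int l" 1 B] by auto
  qed
  show ?thesis using that B mult by blast
qed

text \<open>Modulo l, \<open>B\<close> is c times the sum \<open>S\<close> with 2 S = k (k + 1).
  Both factors are units: l dividing c would force l to divide 4.\<close>

lemma lucas_v_prime_expansion:
  fixes c :: int
  assumes l: "prime l" "l \<ge> 3" and X: "int l dvd c\<^sup>2 - 4"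
  obtains B where "lucas_v c l = c + (c\<^sup>2 - 4) * B" "\<not> int l dvd B"
proof -
  have "odd l" using l prime_odd_nat by auto
  then obtain k where k: "l = 2 * k + 1" by (rule oddE)
  obtain d where d: "lucas_v c l = c * (1 + (c\<^sup>2 - 4) * (\<Sum>i\<le>k. int i) + (c\<^sup>2 - 4)\<^sup>2 * d)"
    using lucas_v_odd_expansion[of c k] k by auto
  define S where "S = (\<Sum>i\<le>k. int i)"
  define B where "B = c * (S + (c\<^sup>2 - 4) * d)"
  have B: "lucas_v c l = c + (c\<^sup>2 - 4) * B"
    unfolding d B_def S_def by (simp add: algebra_simps power2_eq_square)
  have pl: "prime (int l)" using l by simp
  have "\<not> int l dvd int k" "\<not> int l dvd int k + 1"
    using zdvd_not_zless[of "int k" "int l"] zdvd_not_zless[of "int k + 1" "int l"] k l by auto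
  then have "\<not> int l dvd S"
    using sum_times_2[of k] pl by (metis S_def dvd_mult prime_dvd_mult_iff)
  then have "\<not> int l dvd S + (c\<^sup>2 - 4) * d"
    using X by (simp add: dvd_add_left_iff)
  moreover have "\<not> int l dvd c"
  proof
    assume "int l dvd c"
    then have "int l dvd 4"
      using X dvd_diff[of "int l" "c\<^sup>2" "c\<^sup>2 - 4"] by (simp add: power2_eq_square)
    then have "int l dvd 2"
      using prime_dvd_mult_iff[OF pl, of 2 2] by simp
    then show False using zdvd_imp_le[of "int l" 2] l(2) by simp
  qed
  ultimately have "\<not> int l dvd B"
    using pl by (simp add: B_def prime_dvd_mult_iff)
  then show ?thesis using that B by blast
qed

lemma lucas_rho_props:
  assumes "lucas_u a n \<noteq> 0" "int p dvd lucas_u a n"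
  shows "lucas_u a (lucas_rho a p) \<noteq> 0" "int p dvd lucas_u a (lucas_rho a p)"
proof -
  have "n \<ge> 1" using assms by (cases n) auto
  then show "lucas_u a (lucas_rho a p) \<noteq> 0" "int p dvd lucas_u a (lucas_rho a p)"
    using LeastI[of "\<lambda>n. n \<ge> 1 \<and> lucas_u a n \<noteq> 0 \<and> int p dvd lucas_u a n" n] assms
    by (auto simp: lucas_rho_def)
qed

theorem corollary5p4:
  fixes a \<delta> :: int and l \<rho> h :: nat and u v :: "nat \<Rightarrow> int" and r :: ereal
  assumes delta: "\<delta> = a^2 - 4"
    and u: "u = lucas_u a"
    and v: "v = lucas_v a"
    and l: "prime l" "l \<ge> 3" "\<not> int l dvd \<delta>"
    and ex: "\<exists>n. u n \<noteq> 0 \<and> int l dvd u n"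
    and rho: "\<rho> = lucas_rho a l"
    and r: "r = padic_val l (of_int (u \<rho>))"
    and h: "h = (if l = 3 then 1 else 0)"
  shows "padic_val l (of_int (u (l * \<rho>) - int l * u \<rho>)) = 3 * r + 1 - ereal (real h)
       \<and> padic_val l (of_int (v (l * \<rho>) - v \<rho>)) = 2 * r
       \<and> (int l ^ 2 dvd u \<rho> \<longleftrightarrow> int l ^ (7 - h) dvd u (l * \<rho>) - int l * u \<rho>)
       \<and> (int l ^ (7 - h) dvd u (l * \<rho>) - int l * u \<rho> \<longleftrightarrow> int l ^ 4 dvd v (l * \<rho>) - v \<rho>)
       \<and> (int l ^ 4 dvd v (l * \<rho>) - v \<rho> \<longleftrightarrow> int l ^ (5 - h) dvd u (l * \<rho>) - int l * u \<rho>)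
       \<and> (int l ^ (5 - h) dvd u (l * \<rho>) - int l * u \<rho> \<longleftrightarrow> int l ^ 3 dvd v (l * \<rho>) - v \<rho>)
       \<and> r = (padic_val l (of_int (u (l * \<rho>) - int l * u \<rho>)) + ereal (real h) - 1) / 3
       \<and> r = padic_val l (of_int (v (l * \<rho>) - v \<rho>)) / 2"
proof -
  define R where "R = multiplicity (int l) (u \<rho>)"
  have U: "u \<rho> \<noteq> 0" "int l dvd u \<rho>"
    using ex lucas_rho_props unfolding u rho by blast+
  have pl: "prime (int l)" using l by simp
  then have unit: "\<not> is_unit (int l)" by auto
  have X: "(v \<rho>)\<^sup>2 - 4 = \<delta> * (u \<rho>)\<^sup>2"
    using lucas_v_square[of a \<rho>] by (simp add: u v delta)
  have "int l ^ 2 dvd (v \<rho>)\<^sup>2 - 4"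
    using U unfolding X by (simp add: dvd_power_same)
  then obtain B where B: "lucas_u (v \<rho>) l = int l + ((v \<rho>)\<^sup>2 - 4) * B" "B \<noteq> 0"
    "multiplicity (int l) B = (if l = 3 then 0 else 1)"
    using lucas_u_prime_expansion l by blast
  have "int l dvd (v \<rho>)\<^sup>2 - 4"
    using U unfolding X by (simp add: power2_eq_square)
  then obtain C where C: "lucas_v (v \<rho>) l = v \<rho> + ((v \<rho>)\<^sup>2 - 4) * C" "\<not> int l dvd C"
    using lucas_v_prime_expansion l by blast
  \<comment> \<open>The difference is u_\<rho> (u_l(v_\<rho>) - l), and \<open>X\<close> turns the
    factor v_\<rho>^2 - 4 into two more factors u_\<rho>.\<close>
  have du: "u (l * \<rho>) - int l * u \<rho> = \<delta> * u \<rho> ^ 3 * B"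
    using lucas_mult(1)[of a l \<rho>] B(1) X
    by (simp add: u v algebra_simps power2_eq_square power3_eq_cube)
  have dv: "v (l * \<rho>) - v \<rho> = \<delta> * u \<rho> ^ 2 * C"
    using lucas_mult(2)[of a l \<rho>] C(1) X by (simp add: u v)
  have nz: "\<delta> \<noteq> 0" "C \<noteq> 0" using l C by auto
  have mult0: "multiplicity (int l) \<delta> = 0" "multiplicity (int l) C = 0"
    using l C by (simp_all add: not_dvd_imp_multiplicity_0)
  have nz': "u (l * \<rho>) - int l * u \<rho> \<noteq> 0" "v (l * \<rho>) - v \<rho> \<noteq> 0"
    unfolding du dv using nz U B by simp_all
  \<comment> \<open>Since l does not divide \<delta>, only the powers of u_\<rho> and the cofactors
    contribute; \<open>B\<close> contributes 1 - h.\<close>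
  have mu: "multiplicity (int l) (u (l * \<rho>) - int l * u \<rho>) = 3 * R + 1 - h"
    and mv: "multiplicity (int l) (v (l * \<rho>) - v \<rho>) = 2 * R"
    unfolding du dv R_def using nz U B(2,3) mult0 pl
    by (simp_all add: prime_elem_multiplicity_mult_distrib prime_elem_multiplicity_power_distrib h)
  have R: "R \<ge> 1"
    using U unit by (simp add: R_def Suc_leI multiplicity_gt_zero_iff)
  have dvd: "int l ^ n dvd z \<longleftrightarrow> n \<le> multiplicity (int l) z" if "z \<noteq> 0" for n z
    using that unit by (simp add: power_dvd_iff_le_multiplicity)
  have h1: "h \<le> 1" by (simp add: h)
  \<comment> \<open>All five divisibilities reduce to R \<ge> 2: the weaker exponents require 4
    \<le> 3 R and 3 \<le> 2 R, which already exclude R = 1.\<close>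
  show ?thesis
    unfolding r padic_val_of_int[OF U(1)] padic_val_of_int[OF nz'(1)] padic_val_of_int[OF nz'(2)]
      dvd[OF U(1)] dvd[OF nz'(1)] dvd[OF nz'(2)] mu mv R_def[symmetric]
    using R h1 by (auto simp: of_nat_diff one_ereal_def)
qed

end
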